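(* For a positive integer $m$ let $$T_m=\operatorname{conv}\{(0,0,0),(1,0,0),(0,1,0),(1,1,m)\}\subset\mathbb R^3,\qquad \widetilde T_m=T_m+[\mathbf 0,\mathbf e_3],$$ where $\mathbf e_3=(0,0,1)$, $[\mathbf 0,\mathbf e_3]$ is the segment joining $\mathbf 0$ and $\mathbf e_3$, and the sum is a Minkowski sum, and let $$\widetilde T_m^\bullet=\operatorname{conv}\bigl((\widetilde T_m\times\{0\})\cup((-\widetilde T_m)\times\{1\})\bigr)\subset\mathbb R^4.$$ For every positive integer $m$, $\widetilde T_m^\bullet$ is a centrally symmetric minimal covering body for $\mathbb Z^4$. Moreover, the bodies $\widetilde T_m^\bullet$ (for $m=1,2,3,\ldots$, each taken with the lattice $\mathbb Z^4$) have pairwise distinct arithmetic contact types.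
   Context: A convex body in $\mathbb R^n$ is a compact convex set with nonempty interior. A set is centrally symmetric if it is symmetric about some point (not necessarily the origin). Let $\Lambda\subset\mathbb R^n$ be a full-rank lattice. A convex body $K$ is a minimal covering body with respect to (or for) $\Lambda$ if $K+\Lambda=\mathbb R^n$ and no proper convex subbody $K'\subsetneq K$ (i.e. no convex body properly contained in $K$, symmetric or not) satisfies $K'+\Lambda=\mathbb R^n$; then $(K,\Lambda)$ is called a minimal covering pair. (Every minimal covering body is a polytope.) Contact data. For a minimal covering pair $(K,\Lambda)$, let $V(K)$ be the vertex set of $K$ and $\mathcal F(K)$ its face lattice, including $\varnothing$ and $K$. For $\mathbf p\in K$, the face carrier $F_K(\mathbf p)$ is the unique face of $K$ whose relative interior contains $\mathbf p$. For $\mathbf v\in V(K)$ put $$\mathcal Z_K(\mathbf v)=(K-\mathbf v)\cap\Lambda=\{\mathbf z\in\Lambda:\mathbf v+\mathbf z\in K\},\qquad \iota_{\mathbf v}:\mathcal Z_K(\mathbf v)\to\mathcal F(K),\quad \iota_{\mathbf v}(\mathbf z)=F_K(\mathbf v+\mathbf z).$$ Arithmetic contact type. The arithmetic contact profile of $(K,\Lambda)$ consists of $\mathcal F(K)$, $\Lambda$, and the data $\{(\mathcal Z_K(\mathbf v),\mathbf 0,\iota_{\mathbf v}):\mathbf v\in V(K)\}$. For another minimal covering pair $(K',\Lambda')$ (with carrier maps $\iota'$), a profile isomorphism consists of a lattice (group) isomorphism $U:\Lambda\to\Lambda'$, a bijection $\phi:V(K)\to V(K')$, and a face-lattice isomorphism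 $\Phi:\mathcal F(K)\to\mathcal F(K')$ such that (i) $\Phi(\{\mathbf v\})=\{\phi(\mathbf v)\}$ for all $\mathbf v\in V(K)$; (ii) $U\mathcal Z_K(\mathbf v)=\mathcal Z_{K'}(\phi(\mathbf v))$ for all $\mathbf v\in V(K)$; (iii) $\Phi(\iota_{\mathbf v}(\mathbf z))=\iota'_{\phi(\mathbf v)}(U\mathbf z)$ for all $\mathbf v\in V(K)$ and $\mathbf z\in\mathcal Z_K(\mathbf v)$. The same $U$ is used at every vertex. Two minimal covering pairs have the same arithmetic contact type if a profile isomorphism between them exists, and distinct arithmetic contact types otherwise. *)

theory Defs
  imports "HOL-Analysis.Analysis"
begin

section \<open>Minimal covering pairs\<close>

definition convex_body :: "'a::euclidean_space set \<Rightarrow> bool" where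
  "convex_body K \<longleftrightarrow> compact K \<and> convex K \<and> interior K \<noteq> {}"

definition centrally_symmetric :: "'a::real_vector set \<Rightarrow> bool" where
  "centrally_symmetric K \<longleftrightarrow> (\<exists>c. (\<lambda>x. 2 *\<^sub>R c - x) ` K = K)"

definition full_rank_lattice :: "'a::euclidean_space set \<Rightarrow> bool" where
  "full_rank_lattice L \<longleftrightarrow>
     (\<exists>B. independent B \<and> span B = UNIV \<and>
          L = {\<Sum>b\<in>B. of_int (c b) *\<^sub>R b | c :: 'a \<Rightarrow> int. True})"

definition minimal_covering_pair :: "'a::euclidean_space set \<Rightarrow> 'a set \<Rightarrow> bool" where
  "minimal_covering_pair K L \<longleftrightarrow>
     full_rank_lattice L \<and> convex_body K \<and> K + L = UNIV \<and>
     (\<forall>K'. convex_body K' \<and> K' \<subset> K \<longrightarrow> K' + L \<noteq> UNIV)"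

section \<open>Contact data and arithmetic contact type\<close>

definition vertices :: "'a::euclidean_space set \<Rightarrow> 'a set" where
  "vertices K = {v. v extreme_point_of K}"

text \<open>Both the empty set and, for convex \<open>K\<close>, the set \<open>K\<close> itself satisfy \<open>F face_of K\<close>.\<close>

definition faces :: "'a::euclidean_space set \<Rightarrow> 'a set set" where
  "faces K = {F. F face_of K}"

definition face_carrier :: "'a::euclidean_space set \<Rightarrow> 'a \<Rightarrow> 'a set" where
  "face_carrier K p = (THE F. F face_of K \<and> p \<in> rel_interior F)"

definition contact_set :: "'a::euclidean_space set \<Rightarrow> 'a set \<Rightarrow> 'a \<Rightarrow> 'a set" where
  "contact_set K L v = {z \<in> L. v + z \<in> K}"

definition carrier_map :: "'a::euclidean_space set \<Rightarrow> 'a \<Rightarrow> 'a \<Rightarrow> 'a set" where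
  "carrier_map K v z = face_carrier K (v + z)"

definition lattice_isomorphism ::
    "'a::euclidean_space set \<Rightarrow> 'b::euclidean_space set \<Rightarrow> ('a \<Rightarrow> 'b) \<Rightarrow> bool" where
  "lattice_isomorphism L L' U \<longleftrightarrow>
     bij_betw U L L' \<and> (\<forall>x\<in>L. \<forall>y\<in>L. U (x + y) = U x + U y)"

definition face_lattice_isomorphism ::
    "'a::euclidean_space set \<Rightarrow> 'b::euclidean_space set \<Rightarrow> ('a set \<Rightarrow> 'b set) \<Rightarrow> bool" where
  "face_lattice_isomorphism K K' \<Phi> \<longleftrightarrow>
     bij_betw \<Phi> (faces K) (faces K') \<and>
     (\<forall>F\<in>faces K. \<forall>G\<in>faces K. F \<subseteq> G \<longleftrightarrow> \<Phi> F \<subseteq> \<Phi> G)"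

definition profile_isomorphism ::
    "'a::euclidean_space set \<Rightarrow> 'a set \<Rightarrow> 'b::euclidean_space set \<Rightarrow> 'b set \<Rightarrow>
     ('a \<Rightarrow> 'b) \<Rightarrow> ('a \<Rightarrow> 'b) \<Rightarrow> ('a set \<Rightarrow> 'b set) \<Rightarrow> bool" where
  "profile_isomorphism K L K' L' U \<phi> \<Phi> \<longleftrightarrow>
     lattice_isomorphism L L' U \<and>
     bij_betw \<phi> (vertices K) (vertices K') \<and>
     face_lattice_isomorphism K K' \<Phi> \<and>
     (\<forall>v\<in>vertices K. \<Phi> {v} = {\<phi> v}) \<and>
     (\<forall>v\<in>vertices K. U ` contact_set K L v = contact_set K' L' (\<phi> v)) \<and>
     (\<forall>v\<in>vertices K. \<forall>z\<in>contact_set K L v.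
        \<Phi> (carrier_map K v z) = carrier_map K' (\<phi> v) (U z))"

text \<open>Meaningful for minimal covering pairs \<open>(K, L)\<close> and \<open>(K', L')\<close> only.\<close>

definition same_arithmetic_contact_type ::
    "'a::euclidean_space set \<Rightarrow> 'a set \<Rightarrow> 'b::euclidean_space set \<Rightarrow> 'b set \<Rightarrow> bool" where
  "same_arithmetic_contact_type K L K' L' \<longleftrightarrow>
     (\<exists>U \<phi> \<Phi>. profile_isomorphism K L K' L' U \<phi> \<Phi>)"

section \<open>The bodies\<close>

definition integer_lattice :: "(real ^ 'n) set" where
  "integer_lattice = {x. \<forall>i. x $ i \<in> \<int>}"

definition simplex_T :: "nat \<Rightarrow> (real ^ 3) set" where
  "simplex_T m = convex hull
     {vector [0, 0, 0], vector [1, 0, 0], vector [0, 1, 0], vector [1, 1, real m]}"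

definition prism_T :: "nat \<Rightarrow> (real ^ 3) set" where
  "prism_T m = simplex_T m + closed_segment 0 (vector [0, 0, 1])"

text \<open>The point \<open>(x, t)\<close> of \<open>\<real>\<^sup>3 \<times> \<real> = \<real>\<^sup>4\<close>.\<close>

definition snoc4 :: "real ^ 3 \<Rightarrow> real \<Rightarrow> real ^ 4" where
  "snoc4 x t = vector [x $ 1, x $ 2, x $ 3, t]"

text \<open>The pointwise negative of a set is the image under \<^const>\<open>uminus\<close>; on sets the
  prefix minus denotes the complement.\<close>

definition body_T :: "nat \<Rightarrow> (real ^ 4) set" where
  "body_T m = convex hull
     ((\<lambda>x. snoc4 x 0) ` prism_T m \<union> (\<lambda>x. snoc4 x 1) ` (uminus ` prism_T m))"

end

theory Submission
  imports Defs
begin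

text \<open>
  In the coordinates \<open>u = x\<^sub>1 + x\<^sub>4\<close>, \<open>v = x\<^sub>2 + x\<^sub>4\<close>, \<open>t = x\<^sub>4\<close> the projection of the body along the
  third axis is the unit cube, which tiles space under the integer translations of
  \<open>\<real>\<^sup>3\<close>. Above each of the eight corners of the cube the body has a vertical fibre of length exactly
  one with integral end points, and the body is the convex hull of these eight unit segments
  (\<open>body_T_eq\<close>). The map \<open>param\<close>, which is affine in each of its four arguments separately,
  interpolates between the corners and shows that every vertical fibre over the cube has length at
  least one.

  Covering follows at once: reduce a point into the cube by an integer translation, then move it
  into the vertical fibre by another. For minimality, let \<open>K\<close> be a convex covering body inside the
  given one. Over an interior point of the cube no two different integer translates of the cube
  meet, so the translates of one single fibre of \<open>K\<close> by multiples of \<open>e\<^sub>3\<close> cover the whole vertical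
  line, and this fibre has length at least one. Compactness carries this over to the corners of the
  cube. There the fibre of the large body has length one only, so \<open>K\<close> contains all eight unit
  segments and hence their convex hull (\<open>covering_subbody_contains_body\<close>).

  The sixteen end points of the segments are the vertices, and they are also the only lattice
  points of the body (\<open>vertices_body_T\<close>, \<open>lattice_points_of_body\<close>). Therefore the contact vectors
  at a vertex \<open>v\<close> are the differences \<open>w - v\<close> with \<open>w\<close> a vertex, and the carrier of \<open>v + (w - v)\<close> is
  \<open>{w}\<close>. A profile isomorphism \<open>(U, \<phi>, \<Phi>)\<close> must then satisfy \<open>\<phi> w = \<phi> v + U (w - v)\<close>: it is an
  affine equivalence of the two vertex sets. Such an equivalence preserves all relations
  \<open>(a - c) + (b - d) = k (e - f)\<close> among vertices with \<open>e \<noteq> f\<close>, and the largest \<open>k\<close> that occurs for the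
  body with parameter \<open>m\<close> is \<open>m + 2\<close>
  (\<open>affine_ratios_corners_max\<close>, \<open>affine_ratios_corners_le\<close>). So \<open>m\<close> can be recovered from the
  contact type.
\<close>

section \<open>The body as a convex hull of unit segments over a cube\<close>

lemma vector_4 [simp]:
  "(vector [x, y, z, w] :: 'a::zero ^ 4) $ 1 = x"
  "(vector [x, y, z, w] :: 'a ^ 4) $ 2 = y"
  "(vector [x, y, z, w] :: 'a ^ 4) $ 3 = z"
  "(vector [x, y, z, w] :: 'a ^ 4) $ 4 = w"
  unfolding vector_def by simp_all

lemma vec4_eq_iff:
  "p = q \<longleftrightarrow> p $ 1 = q $ 1 \<and> p $ 2 = q $ 2 \<and> p $ 3 = q $ 3 \<and> p $ 4 = q $ 4" for p q :: "'a ^ 4"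
  by (simp add: vec_eq_iff forall_4)

lemma linear_le_on_convex_hull:
  fixes f :: "'a::real_vector \<Rightarrow> real"
  assumes "linear f" "\<And>x. x \<in> S \<Longrightarrow> f x \<le> c" "p \<in> convex hull S"
  shows "f p \<le> c"
proof -
  have "f p \<in> convex hull (f ` S)"
    using assms(1,3) by (auto simp flip: convex_hull_linear_image)
  also have "\<dots> \<subseteq> {..c}"
    using assms(2) by (intro hull_minimal) auto
  finally show ?thesis by simp
qed

text \<open>The lower boundary of the prism over the corner \<open>(u, v)\<close> of the unit square is \<open>m u v\<close>. The
  top slice of the body is the negated prism, and there the corner \<open>(u, v)\<close> of the cube comes
  from the corner \<open>(1 - u, 1 - v)\<close> of the prism. The formula interpolates affinely in \<open>t\<close> between
  the two slices.\<close>

definition height :: "nat \<Rightarrow> real \<Rightarrow> real \<Rightarrow> real \<Rightarrow> real" where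
  "height m u v t = real m * ((1 - t) * (u * v) - t * ((1 - u) * (1 - v)))"

text \<open>The summand \<open>- t\<close> in the third coordinate shifts the negated unit segment \<open>[-1, 0]\<close> of the top
  slice, so that the fibre over every corner is traversed by \<open>s\<close> running from \<open>0\<close> to \<open>1\<close>.\<close>

definition param :: "nat \<Rightarrow> real \<Rightarrow> real \<Rightarrow> real \<Rightarrow> real \<Rightarrow> real ^ 4" where
  "param m u v t s = vector [u - t, v - t, height m u v t - t + s, t]"

lemma param_nth [simp]:
  "param m u v t s $ 1 = u - t" "param m u v t s $ 2 = v - t"
  "param m u v t s $ 3 = height m u v t - t + s" "param m u v t s $ 4 = t"
  by (simp_all add: param_def)

abbreviation bits :: "real set" where
  "bits \<equiv> {0, 1}"

definition corners :: "nat \<Rightarrow> (real ^ 4) set" where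
  "corners m = (\<lambda>(u, v, t, s). param m u v t s) ` (bits \<times> bits \<times> bits \<times> bits)"

lemma param_mem_corners:
  "\<lbrakk>u \<in> bits; v \<in> bits; t \<in> bits; s \<in> bits\<rbrakk> \<Longrightarrow> param m u v t s \<in> corners m"
  unfolding corners_def by (rule image_eqI[where x = "(u, v, t, s)"]) (simp_all only: prod.case mem_Sigma_iff)

lemma cornersE:
  assumes "p \<in> corners m"
  obtains u v t s where "p = param m u v t s" "u \<in> bits" "v \<in> bits" "t \<in> bits" "s \<in> bits"
proof -
  obtain x where "x \<in> bits \<times> bits \<times> bits \<times> bits" "p = (\<lambda>(u, v, t, s). param m u v t s) x"
    using assms unfolding corners_def by (rule imageE)
  then show thesis
    by (cases x) (use that in \<open>simp only: prod.case mem_Sigma_iff\<close>)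
qed

lemma prism_T_eq:
  "prism_T m = convex hull
     ((\<lambda>(u, v, s). vector [u, v, real m * (u * v) + s]) ` (bits \<times> bits \<times> bits))"
proof -
  have add: "vector [a, b, c] + vector [a', b', c'] = (vector [a + a', b + b', c + c'] :: real ^ 3)"
    for a b c a' b' c'
    by (simp add: vec_eq_iff forall_3)
  have zero: "0 = (vector [0, 0, 0] :: real ^ 3)"
    by (simp add: vec_eq_iff forall_3)
  have "{vector [0, 0, 0], vector [1, 0, 0], vector [0, 1, 0], vector [1, 1, real m]} + {0, vector [0, 0, 1]}
      = (\<lambda>(u, v, s). vector [u, v, real m * (u * v) + s] :: real ^ 3) ` (bits \<times> bits \<times> bits)"
    unfolding zero by (simp add: set_plus_def add insert_Times_insert) (auto simp: add)
  then show ?thesis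
    unfolding prism_T_def simplex_T_def segment_convex_hull
    by (simp only: convex_hull_set_plus[symmetric])
qed

text \<open>Convex hulls commute with Minkowski sums and with affine images; so the sixteen points
  come from the eight corner points of the prism and their negatives.\<close>

lemma body_T_eq: "body_T m = convex hull (corners m)"
proof -
  define A where "A = (\<lambda>(u, v, s). vector [u, v, real m * (u * v) + s] :: real ^ 3) ` (bits \<times> bits \<times> bits)"
  let ?f = "\<lambda>x. snoc4 x 0" and ?g = "\<lambda>x. snoc4 (- x) 1"
  have lin_f: "linear ?f"
    by (rule linearI) (simp_all add: snoc4_def vec4_eq_iff)
  have g_eq: "?g = (\<lambda>x. axis 4 1 + x) \<circ> ?f \<circ> uminus"
    by (auto simp: snoc4_def vec4_eq_iff axis_def)
  have f_hull: "?f ` (convex hull A) = convex hull (?f ` A)"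
    by (rule convex_hull_linear_image[OF lin_f])
  have g_hull: "?g ` (convex hull A) = convex hull (?g ` A)"
    unfolding g_eq image_comp[symmetric]
    by (simp add: convex_hull_translation convex_hull_linear_image[OF lin_f]
        convex_hull_linear_image[OF linear_uminus])
  have "?f ` A = (\<lambda>(u, v, s). param m u v 0 s) ` (bits \<times> bits \<times> bits)"
    unfolding A_def image_image by (intro image_cong) (auto simp: snoc4_def vec4_eq_iff height_def)
  moreover have "?g ` A = (\<lambda>(u, v, s). param m u v 1 s) ` (bits \<times> bits \<times> bits)"
  proof -
    have "?g ` A = (\<lambda>(u, v, s). param m u v 1 s) ` (\<lambda>(u, v, s). (1 - u, 1 - v, 1 - s)) `
        (bits \<times> bits \<times> bits)"
      unfolding A_def image_image by (intro image_cong) (auto simp: snoc4_def vec4_eq_iff height_def)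
    moreover have "(\<lambda>(u, v, s). (1 - u, 1 - v, 1 - s)) ` (bits \<times> bits \<times> bits) = bits \<times> bits \<times> bits"
      by (auto simp: image_iff)
    ultimately show ?thesis by (simp only:)
  qed
  ultimately have "?f ` A \<union> ?g ` A = corners m"
    unfolding corners_def by (simp add: insert_Times_insert) (blast)
  moreover have "body_T m = convex hull (?f ` (convex hull A) \<union> ?g ` (convex hull A))"
    unfolding body_T_def prism_T_eq image_image A_def ..
  ultimately show ?thesis
    unfolding f_hull g_hull by (simp flip: hull_Un_left hull_Un_right)
qed

text \<open>Although \<open>param\<close> is not affine, it is affine in each argument, so the cube \<open>[0,1]\<^sup>4\<close> can be
  filled in one coordinate at a time, starting from its corners.\<close>

lemma param_mem_body:
  assumes "u \<in> {0..1}" "v \<in> {0..1}" "t \<in> {0..1}" "s \<in> {0..1}"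
  shows "param m u v t s \<in> body_T m"
proof -
  have conv: "(1 - r) *\<^sub>R p + r *\<^sub>R q \<in> body_T m"
    if "p \<in> body_T m" "q \<in> body_T m" "r \<in> {0..1}" for p q r
    using that convex_convex_hull[of "corners m"] unfolding convex_alt body_T_eq by auto
  have corner: "param m u v t s \<in> body_T m" if "u \<in> bits" "v \<in> bits" "t \<in> bits" "s \<in> bits" for u v t s
    unfolding body_T_eq by (rule hull_inc) (rule param_mem_corners[OF that])
  have u: "param m u v t s = (1 - u) *\<^sub>R param m 0 v t s + u *\<^sub>R param m 1 v t s" for u v t s
    by (simp add: vec4_eq_iff height_def algebra_simps)
  have v: "param m u v t s = (1 - v) *\<^sub>R param m u 0 t s + v *\<^sub>R param m u 1 t s" for u v t s
    by (simp add: vec4_eq_iff height_def algebra_simps)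
  have t: "param m u v t s = (1 - t) *\<^sub>R param m u v 0 s + t *\<^sub>R param m u v 1 s" for u v t s
    by (simp add: vec4_eq_iff height_def algebra_simps)
  have s: "param m u v t s = (1 - s) *\<^sub>R param m u v t 0 + s *\<^sub>R param m u v t 1" for u v t s
    by (simp add: vec4_eq_iff height_def algebra_simps)
  have 1: "param m u v t s \<in> body_T m" if "v \<in> bits" "t \<in> bits" "s \<in> bits" for v t s
    unfolding u[of u] using that assms by (intro conv corner) auto
  have 2: "param m u v t s \<in> body_T m" if "t \<in> bits" "s \<in> bits" for t s
    unfolding v[of u v] using that assms by (intro conv 1) auto
  have 3: "param m u v t s \<in> body_T m" if "s \<in> bits" for s
    unfolding t[of u v t] using that assms by (intro conv 2) auto
  show ?thesis
    unfolding s[of u v t s] using assms by (intro conv 3) auto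
qed

lemma body_subset_slab:
  assumes "p \<in> body_T m"
  shows "p $ 4 \<in> {0..1}" "p $ 1 + p $ 4 \<in> {0..1}" "p $ 2 + p $ 4 \<in> {0..1}"
proof -
  have lower: "(0::real) \<le> f p" and upper: "f p \<le> 1"
    if "linear f" "\<And>q. q \<in> corners m \<Longrightarrow> f q \<in> {0..1}" for f
    using that linear_le_on_convex_hull[of f "corners m" 1 p]
      linear_le_on_convex_hull[of "\<lambda>q. - f q" "corners m" 0 p] assms
    by (auto simp: body_T_eq linear_compose_neg)
  have "linear (\<lambda>q :: real ^ 4. q $ 4)" "linear (\<lambda>q :: real ^ 4. q $ 1 + q $ 4)"
      "linear (\<lambda>q :: real ^ 4. q $ 2 + q $ 4)"
    by (simp_all add: linear_iff algebra_simps)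
  moreover have "q $ 4 \<in> {0..1}" "q $ 1 + q $ 4 \<in> {0..1}" "q $ 2 + q $ 4 \<in> {0..1}"
    if "q \<in> corners m" for q
    using that by (elim cornersE; auto)+
  ultimately show "p $ 4 \<in> {0..1}" "p $ 1 + p $ 4 \<in> {0..1}" "p $ 2 + p $ 4 \<in> {0..1}"
    using lower upper unfolding atLeastAtMost_iff by blast+
qed

text \<open>The \<open>\<ell>\<^sub>1\<close> distance of \<open>(u, v, t)\<close> from a corner \<open>(a, b, c)\<close> of the cube is an affine function on
  the cube, and it is at least \<open>1\<close> at every other corner. Adding a large multiple \<open>C\<close> of it to the
  bounds for the third coordinate over that corner gives affine inequalities which hold at all
  sixteen points, hence on the whole body, and which are sharp over the corner itself.\<close>

lemma body_fiber_over_corner: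
  assumes p: "p \<in> body_T m"
    and bits: "p $ 1 + p $ 4 \<in> bits" "p $ 2 + p $ 4 \<in> bits" "p $ 4 \<in> bits"
  obtains s where "0 \<le> s" "s \<le> 1" "p = param m (p $ 1 + p $ 4) (p $ 2 + p $ 4) (p $ 4) s"
proof -
  define a b c where "a = p $ 1 + p $ 4" and "b = p $ 2 + p $ 4" and "c = p $ 4"
  \<comment> \<open>All third coordinates of corner points lie in \<open>[-m - 1, m + 1]\<close>, so they differ by less than \<open>C\<close>.\<close>
  define C where "C = 2 * real m + 3"
  \<comment> \<open>The linear part of the distance, which is \<open>dist q + (a + b + c)\<close>.\<close>
  define dist where "dist q = (1 - 2 * a) * (q $ 1 + q $ 4) + (1 - 2 * b) * (q $ 2 + q $ 4)
      + (1 - 2 * c) * q $ 4" for q :: "real ^ 4"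
  note bound = linear_le_on_convex_hull[OF _ _ p[unfolded body_T_eq]]
  have p_eq: "p $ 1 = a - c" "p $ 2 = b - c" "p $ 4 = c"
    by (simp_all add: a_def b_def c_def)
  have abc: "a \<in> bits" "b \<in> bits" "c \<in> bits"
    using bits by (simp_all add: a_def b_def c_def)
  have "p $ 3 - C * dist p \<le> height m a b c - c + 1 + C * (a + b + c)"
  proof (rule bound)
    show "linear (\<lambda>p. p $ 3 - C * dist p)"
      by (simp add: linear_iff dist_def algebra_simps)
    show "q $ 3 - C * dist q \<le> height m a b c - c + 1 + C * (a + b + c)" if "q \<in> corners m" for q
      using that abc by (elim cornersE) (auto simp: dist_def C_def height_def)
  qed
  moreover have "- p $ 3 - C * dist p \<le> - (height m a b c - c) + C * (a + b + c)"
  proof (rule bound)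
    show "linear (\<lambda>p. - p $ 3 - C * dist p)"
      by (simp add: linear_iff dist_def algebra_simps)
    show "- q $ 3 - C * dist q \<le> - (height m a b c - c) + C * (a + b + c)" if "q \<in> corners m" for q
      using that abc by (elim cornersE) (auto simp: dist_def C_def height_def)
  qed
  moreover have "dist p = - (a + b + c)"
    using abc by (auto simp: dist_def p_eq)
  ultimately have "height m a b c - c \<le> p $ 3" "p $ 3 \<le> height m a b c - c + 1"
    by (simp_all add: algebra_simps)
  then show thesis
    by (intro that[of "p $ 3 - (height m a b c - c)"])
       (simp_all add: vec4_eq_iff p_eq)
qed

section \<open>Vertices and lattice points\<close>

lemma height_Ints: "\<lbrakk>u \<in> \<int>; v \<in> \<int>; t \<in> \<int>\<rbrakk> \<Longrightarrow> height m u v t \<in> \<int>"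
  by (simp add: height_def)

lemma Ints_unit_interval:
  assumes "x \<in> \<int>" "x \<in> {0..1::real}"
  shows "x \<in> bits"
proof -
  obtain k where "x = of_int k"
    using assms(1) by (rule Ints_cases)
  with assms(2) have "k = 0 \<or> k = 1" by auto
  with \<open>x = of_int k\<close> show ?thesis by auto
qed

text \<open>A lattice point of the body projects to a lattice point of the cube, which is a corner; the
  fibre over a corner is a unit segment with integral end points.\<close>

lemma lattice_points_of_body: "body_T m \<inter> integer_lattice = corners m"
proof (intro equalityI subsetI)
  fix p assume "p \<in> body_T m \<inter> integer_lattice"
  then have p: "p \<in> body_T m" and int: "p $ i \<in> \<int>" for i
    by (auto simp: integer_lattice_def)
  have bits: "p $ 1 + p $ 4 \<in> bits" "p $ 2 + p $ 4 \<in> bits" "p $ 4 \<in> bits"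
    by (intro Ints_unit_interval Ints_add int body_subset_slab[OF p])+
  obtain s where s: "0 \<le> s" "s \<le> 1" "p = param m (p $ 1 + p $ 4) (p $ 2 + p $ 4) (p $ 4) s"
    using body_fiber_over_corner[OF p bits] .
  have "p $ 3 = height m (p $ 1 + p $ 4) (p $ 2 + p $ 4) (p $ 4) - p $ 4 + s"
    by (subst s(3)) simp
  then have "s = p $ 3 - height m (p $ 1 + p $ 4) (p $ 2 + p $ 4) (p $ 4) + p $ 4"
    by simp
  also have "\<dots> \<in> \<int>"
    by (intro Ints_add Ints_diff height_Ints int)
  finally have "s \<in> bits"
    using s(1,2) by (intro Ints_unit_interval) auto
  then show "p \<in> corners m"
    by (subst s(3)) (intro param_mem_corners bits)
next
  fix p assume p: "p \<in> corners m"
  have "p $ i \<in> \<int>" for i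
    using exhaust_4[of i] p by (elim cornersE disjE) (auto simp: height_def)
  with p show "p \<in> body_T m \<inter> integer_lattice"
    by (auto simp: integer_lattice_def body_T_eq hull_inc)
qed

lemma segment_through_endpoint:
  fixes x y r :: real
  assumes "x \<in> {0..1}" "y \<in> {0..1}" "0 < r" "r < 1" "(1 - r) * x + r * y \<in> bits"
  shows "x = (1 - r) * x + r * y \<and> y = (1 - r) * x + r * y"
proof (cases "(1 - r) * x + r * y = 0")
  case True
  moreover have "0 \<le> (1 - r) * x" "0 \<le> r * y"
    using assms by simp_all
  ultimately have "(1 - r) * x = 0" "r * y = 0"
    by linarith+
  with assms show ?thesis by simp
next
  case False
  then have "(1 - r) * (1 - x) + r * (1 - y) = 0"
    using assms(5) by (simp add: algebra_simps)
  moreover have "0 \<le> (1 - r) * (1 - x)" "0 \<le> r * (1 - y)"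
    using assms by simp_all
  ultimately have "(1 - r) * (1 - x) = 0" "r * (1 - y) = 0"
    by linarith+
  with assms show ?thesis by simp
qed

text \<open>If a corner point lies inside a segment of the body, then both ends of the segment project to
  the same corner of the cube, because each cube coordinate is extremal there. Both ends therefore
  lie in the unit segment over this corner, of which the given point is an end.\<close>

lemma vertices_body_T: "vertices (body_T m) = corners m"
proof (intro equalityI subsetI)
  show "p \<in> corners m" if "p \<in> vertices (body_T m)" for p
    using that unfolding vertices_def body_T_eq by (auto intro: extreme_point_of_convex_hull)
next
  fix p assume "p \<in> corners m"
  then obtain u v t s where p: "p = param m u v t s" and bits: "u \<in> bits" "v \<in> bits" "t \<in> bits" "s \<in> bits"
    by (rule cornersE)
  have "p \<notin> open_segment a b" if a: "a \<in> body_T m" and b: "b \<in> body_T m" for a b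
  proof
    assume "p \<in> open_segment a b"
    then obtain r where "a \<noteq> b" and r: "0 < r" "r < 1" and "p = (1 - r) *\<^sub>R a + r *\<^sub>R b"
      by (auto simp: in_segment)
    then have nth: "p $ i = (1 - r) * a $ i + r * b $ i" for i
      by simp
    have t_eq: "a $ 4 = t" "b $ 4 = t"
      using segment_through_endpoint[OF body_subset_slab(1)[OF a] body_subset_slab(1)[OF b] r]
        nth[of 4] bits by (simp_all add: p)
    have "(1 - r) * (a $ 1 + a $ 4) + r * (b $ 1 + b $ 4) = u"
      "(1 - r) * (a $ 2 + a $ 4) + r * (b $ 2 + b $ 4) = v"
      using nth[of 1] nth[of 2] nth[of 4] by (simp_all add: p algebra_simps)
    then have uv_eq: "a $ 1 + a $ 4 = u" "b $ 1 + b $ 4 = u" "a $ 2 + a $ 4 = v" "b $ 2 + b $ 4 = v"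
      using segment_through_endpoint[OF body_subset_slab(2)[OF a] body_subset_slab(2)[OF b] r]
        segment_through_endpoint[OF body_subset_slab(3)[OF a] body_subset_slab(3)[OF b] r] bits
      by metis+
    obtain x where x: "0 \<le> x" "x \<le> 1" "a = param m u v t x"
      by (rule body_fiber_over_corner[OF a, unfolded uv_eq, unfolded t_eq, OF bits(1-3)])
    obtain y where y: "0 \<le> y" "y \<le> 1" "b = param m u v t y"
      by (rule body_fiber_over_corner[OF b, unfolded uv_eq, unfolded t_eq, OF bits(1-3)])
    have "(1 - r) * x + r * y = s"
      using nth[of 3] by (simp add: p x(3) y(3) algebra_simps)
    then have "x = y"
      using segment_through_endpoint[of x y r] x(1,2) y(1,2) r bits(4) by auto
    with \<open>a \<noteq> b\<close> x(3) y(3) show False by simp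
  qed
  moreover have "p \<in> body_T m"
    using \<open>p \<in> corners m\<close> by (simp add: body_T_eq hull_inc)
  ultimately show "p \<in> vertices (body_T m)"
    by (simp add: vertices_def extreme_point_of_def)
qed

text \<open>The reflection about \<open>(0, 0, 0, 1/2)\<close> interchanges the two slices; in parameters it
  replaces each of \<open>u\<close>, \<open>v\<close>, \<open>t\<close>, \<open>s\<close> by its complement to \<open>1\<close>.\<close>

lemma centrally_symmetric_body_T: "centrally_symmetric (body_T m)"
proof -
  define c :: "real ^ 4" where "c = vector [0, 0, 0, 1 / 2]"
  let ?\<rho> = "\<lambda>x. 2 *\<^sub>R c - x"
  have \<rho>_eq: "?\<rho> = (\<lambda>x. 2 *\<^sub>R c + x) \<circ> uminus"
    by auto
  have "?\<rho> (param m u v t s) = param m (1 - u) (1 - v) (1 - t) (1 - s)" for u v t s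
    by (simp add: c_def vec4_eq_iff height_def algebra_simps)
  then have "?\<rho> p \<in> corners m" if "p \<in> corners m" for p
    using that by (elim cornersE) (auto intro: param_mem_corners)
  then have "?\<rho> ` corners m \<subseteq> corners m"
    by blast
  moreover have "?\<rho> ` ?\<rho> ` corners m = corners m"
    by (simp add: image_image)
  ultimately have "?\<rho> ` corners m = corners m"
    by (metis image_mono subset_antisym)
  moreover have "?\<rho> ` (convex hull S) = convex hull (?\<rho> ` S)" for S
    unfolding \<rho>_eq image_comp[symmetric]
    by (simp add: convex_hull_translation convex_hull_linear_image[OF linear_uminus])
  ultimately show ?thesis
    unfolding centrally_symmetric_def body_T_eq by metis
qed

section \<open>Minimal covering\<close>

lemma convex_body_body_T: "convex_body (body_T m)"
proof -
  have "finite (corners m)"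
    by (simp add: corners_def)
  then have "compact (body_T m)"
    unfolding body_T_eq by (rule finite_imp_compact_convex_hull)
  moreover have "convex (body_T m)"
    by (simp add: body_T_eq)
  moreover have "interior (body_T m) \<noteq> {}"
  proof
    assume "interior (body_T m) = {}"
    then obtain a b where "a \<noteq> 0" and sub: "body_T m \<subseteq> {x. a \<bullet> x = b}"
      using empty_interior_subset_hyperplane[OF \<open>convex (body_T m)\<close>] by metis
    have eq: "a \<bullet> param m u v t s = b" if "u \<in> bits" "v \<in> bits" "t \<in> bits" "s \<in> bits" for u v t s
      using sub param_mem_body[of u v t s m] that by auto
    \<comment> \<open>Five affinely independent corner points: they cannot lie in a common hyperplane.\<close>
    have "a $ 1 = 0 \<and> a $ 2 = 0 \<and> a $ 3 = 0 \<and> a $ 4 = 0"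
      using eq[of 0 0 0 0] eq[of 0 0 0 1] eq[of 1 0 0 0] eq[of 0 1 0 0] eq[of 1 1 1 0]
      by (simp add: inner_vec_def sum_4 height_def)
    then have "a = 0"
      by (simp add: vec4_eq_iff)
    with \<open>a \<noteq> 0\<close> show False ..
  qed
  ultimately show ?thesis
    unfolding convex_body_def by blast
qed

lemma full_rank_integer_lattice: "full_rank_lattice (integer_lattice :: (real ^ 'n) set)"
proof -
  let ?L = "{\<Sum>b\<in>Basis. of_int (c b) *\<^sub>R b | c :: real ^ 'n \<Rightarrow> int. True}"
  have "integer_lattice = ?L"
  proof (intro equalityI subsetI)
    fix x :: "real ^ 'n" assume "x \<in> integer_lattice"
    then have "of_int \<lfloor>x \<bullet> b\<rfloor> = x \<bullet> b" if "b \<in> Basis" for b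
      using that by (auto simp: integer_lattice_def Basis_vec_def inner_axis) (metis Ints_cases)
    then have "x = (\<Sum>b\<in>Basis. of_int \<lfloor>x \<bullet> b\<rfloor> *\<^sub>R b)"
      by (subst euclidean_representation[of x, symmetric]) (rule sum.cong, simp_all only:)
    then show "x \<in> ?L" 
      by (intro CollectI exI[of _ "\<lambda>b. \<lfloor>x \<bullet> b\<rfloor>"]) simp
  next
    fix x assume "x \<in> ?L"
    then obtain c where x: "x = (\<Sum>b\<in>Basis. of_int (c b) *\<^sub>R b)"
      by blast
    have "(of_int (c b) *\<^sub>R b) $ i \<in> \<int>" if "b \<in> Basis" for b :: "real ^ 'n" and i
      using that by (auto simp: Basis_vec_def axis_def)
    then show "x \<in> integer_lattice"
      unfolding x integer_lattice_def by (auto simp del: vector_scaleR_component intro!: Ints_sum)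
  qed
  then show ?thesis
    unfolding full_rank_lattice_def using independent_Basis span_Basis by blast
qed

lemma body_T_covers: "body_T m + integer_lattice = UNIV"
proof -
  have "p \<in> body_T m + integer_lattice" for p
  proof -
    define t u v where "t = frac (p $ 4)" and "u = frac (p $ 1 + t)" and "v = frac (p $ 2 + t)"
    define s where "s = frac (p $ 3 - (height m u v t - t))"
    define q where "q = param m u v t s"
    have "q \<in> body_T m"
      unfolding q_def by (rule param_mem_body) (simp_all add: t_def u_def v_def s_def frac_lt_1 less_imp_le)
    moreover have "p - q \<in> integer_lattice"
    proof -
      have frac: "x - frac x \<in> \<int>" for x :: real
        by (simp add: frac_def)
      have "p $ 4 - t \<in> \<int>" "p $ 1 + t - u \<in> \<int>" "p $ 2 + t - v \<in> \<int>"
          "p $ 3 - (height m u v t - t) - s \<in> \<int>"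
        using frac[of "p $ 4"] frac[of "p $ 1 + t"] frac[of "p $ 2 + t"]
          frac[of "p $ 3 - (height m u v t - t)"]
        by (simp_all only: flip: t_def u_def v_def s_def)
      then have "(p - q) $ i \<in> \<int>" for i
        using exhaust_4[of i] by (elim disjE) (simp_all add: q_def algebra_simps)
      then show ?thesis
        by (simp add: integer_lattice_def)
    qed
    ultimately show ?thesis
      using set_plus_intro[of q _ "p - q"] by simp
  qed
  then show ?thesis by blast
qed

text \<open>A compact interval whose integer translates cover the line has length at least one:
  otherwise the gap between it and its translate by \<open>1\<close> is left uncovered.\<close>

lemma unit_step_in_covering_fiber:
  fixes F :: "real set"
  assumes "compact F" "convex F" and cover: "\<And>y. \<exists>x\<in>F. y - x \<in> \<int>"
  obtains x where "x \<in> F" "x + 1 \<in> F"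
proof -
  have "F \<noteq> {}"
    using cover by blast
  obtain a where a: "a \<in> F" "\<And>x. x \<in> F \<Longrightarrow> a \<le> x"
    using compact_attains_inf[OF \<open>compact F\<close> \<open>F \<noteq> {}\<close>] by blast
  obtain b where b: "b \<in> F" "\<And>x. x \<in> F \<Longrightarrow> x \<le> b"
    using compact_attains_sup[OF \<open>compact F\<close> \<open>F \<noteq> {}\<close>] by blast
  have "a + 1 \<le> b"
  proof (rule ccontr)
    assume "\<not> a + 1 \<le> b"
    then obtain y where y: "b < y" "y < a + 1"
      by (meson dense not_le)
    obtain x where x: "x \<in> F" "y - x \<in> \<int>"
      using cover by blast
    obtain k where "y - x = of_int k"
      using x(2) by (rule Ints_cases)
    with a(2)[OF x(1)] b(2)[OF x(1)] y have "0 < (of_int k :: real)" "(of_int k :: real) < 1"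
      by linarith+
    then show False by simp
  qed
  moreover have "closed_segment a b \<subseteq> F"
    using a(1) b(1) \<open>convex F\<close> by (simp add: closed_segment_subset)
  ultimately have "a + 1 \<in> F"
    by (auto simp: closed_segment_eq_real_ivl)
  with a(1) show thesis by (rule that)
qed

text \<open>The set \<open>W\<close> of all lower ends of vertical unit segments in \<open>K\<close> is compact. Its projection to the
  cube contains every interior point of the cube, hence the closed cube and in particular
  the corners. The eight unit segments found over the corners are those which span the body.\<close>

lemma covering_subbody_contains_body:
  assumes K: "convex K" "compact K" "K \<subseteq> body_T m" and cover: "K + integer_lattice = UNIV"
  shows "body_T m \<subseteq> K"
proof -
  define e :: "real ^ 4" where "e = axis 3 1"
  define q :: "real ^ 4 \<Rightarrow> real \<times> real \<times> real" where "q p = (p $ 1 + p $ 4, p $ 2 + p $ 4, p $ 4)" for p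
  define W where "W = {p \<in> K. p + e \<in> K}"
  have W_eq: "W = K \<inter> (\<lambda>x. - e + x) ` K"
    by (auto simp: W_def image_iff algebra_simps)
  have "compact W"
    unfolding W_eq by (intro compact_Int compact_translation K)
  have "continuous_on W q"
    unfolding q_def by (intro continuous_intros)
  then have "closed (q ` W)"
    using \<open>compact W\<close> by (intro compact_imp_closed compact_continuous_image)
  have inside: "(u, v, t) \<in> q ` W" if "u \<in> {0<..<1}" "v \<in> {0<..<1}" "t \<in> {0<..<1}" for u v t
  proof -
    define l where "l z = (vector [u - t, v - t, z, t] :: real ^ 4)" for z
    define F where "F = {z. l z \<in> K}"
    have "F = (\<lambda>p. p $ 3) ` (K \<inter> {p. p $ 1 = u - t} \<inter> {p. p $ 2 = v - t} \<inter> {p. p $ 4 = t})" (is "_ = _ ` ?S")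
    proof (intro equalityI subsetI)
      show "z \<in> (\<lambda>p. p $ 3) ` ?S" if "z \<in> F" for z
        using that by (intro image_eqI[of _ _ "l z"]) (simp_all add: F_def l_def)
      show "z \<in> F" if "z \<in> (\<lambda>p. p $ 3) ` ?S" for z
      proof -
        from that obtain p where p: "p \<in> ?S" "z = p $ 3"
          by blast
        then have "p = l z"
          by (simp add: l_def vec4_eq_iff)
        with p(1) show ?thesis by (simp add: F_def)
      qed
    qed
    moreover have "compact ?S"
      by (intro compact_Int_closed K closed_Collect_eq continuous_intros)
    ultimately have "compact F"
      by (auto intro!: compact_continuous_image continuous_intros)
    have "convex F"
    proof (rule convexI)
      fix x y a b :: real assume "x \<in> F" "y \<in> F" "0 \<le> a" "0 \<le> b" "a + b = 1"
      moreover from \<open>a + b = 1\<close> have "l (a *\<^sub>R x + b *\<^sub>R y) = a *\<^sub>R l x + b *\<^sub>R l y"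
        by (simp add: l_def vec4_eq_iff flip: distrib_right)
      ultimately show "a *\<^sub>R x + b *\<^sub>R y \<in> F"
        using convexD[OF K(1), of "l x" "l y" a b] by (simp add: F_def)
    qed
    have "\<exists>x\<in>F. y - x \<in> \<int>" for y
    proof -
      have "l y \<in> K + integer_lattice"
        by (simp add: cover)
      then obtain k n where k: "k \<in> K" and n: "n \<in> integer_lattice" and sum: "l y = k + n"
        by (rule set_plus_elim)
      have int: "n $ i \<in> \<int>" for i
        using n by (simp add: integer_lattice_def)
      have nth: "u - t = k $ 1 + n $ 1" "v - t = k $ 2 + n $ 2" "y = k $ 3 + n $ 3" "t = k $ 4 + n $ 4"
        using sum by (simp_all add: l_def vec4_eq_iff)
      \<comment> \<open>An integer that carries a number from \<open>[0, 1]\<close> into the open interval \<open>(0, 1)\<close>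
         vanishes: this confines the translation vector to the vertical direction.\<close>
      have zero: "i = 0" if "i \<in> \<int>" "x \<in> {0..1}" "x + i \<in> {0<..<1}" for i x :: real
      proof -
        obtain j where "i = of_int j"
          using \<open>i \<in> \<int>\<close> by (rule Ints_cases)
        with that have "(of_int j :: real) < 1" "(-1 :: real) < of_int j"
          by auto
        then have "j = 0" by linarith
        with \<open>i = of_int j\<close> show ?thesis by simp
      qed
      note slab = body_subset_slab[OF subsetD[OF K(3) k]]
      have n4: "n $ 4 = 0"
        using nth that by (intro zero[OF int slab(1)]) auto
      moreover have "n $ 1 = 0"
        using nth that n4 by (intro zero[OF int slab(2)]) (auto simp: algebra_simps)
      moreover have "n $ 2 = 0"
        using nth that n4 by (intro zero[OF int slab(3)]) (auto simp: algebra_simps)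
      ultimately have "k = l (k $ 3)"
        using nth by (simp add: l_def vec4_eq_iff)
      then have "k $ 3 \<in> F"
        using k by (simp add: F_def)
      moreover have "y - k $ 3 \<in> \<int>"
        using int[of 3] nth(3) by simp
      ultimately show ?thesis by blast
    qed
    then obtain z where "z \<in> F" "z + 1 \<in> F"
      using unit_step_in_covering_fiber[OF \<open>compact F\<close> \<open>convex F\<close>] by blast
    moreover have "l (z + 1) = l z + e"
      by (simp add: l_def e_def vec4_eq_iff axis_def)
    ultimately have "l z \<in> W"
      by (simp add: W_def F_def)
    moreover have "q (l z) = (u, v, t)"
      by (simp add: q_def l_def)
    ultimately show ?thesis
      by (metis imageI)
  qed
  have "{0..1} \<times> {0..1} \<times> {0..1} = closure ({0<..<1::real} \<times> {0<..<1::real} \<times> {0<..<1::real})"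
    by (simp add: closure_Times)
  also have "\<dots> \<subseteq> q ` W"
    using inside \<open>closed (q ` W)\<close> by (intro closure_minimal) auto
  finally have cube: "{0..1} \<times> {0..1} \<times> {0..1} \<subseteq> q ` W" .
  have both: "param m u v t 0 \<in> K \<and> param m u v t 1 \<in> K" if bits: "u \<in> bits" "v \<in> bits" "t \<in> bits" for u v t
  proof -
    have "(u, v, t) \<in> q ` W"
      using bits by (intro subsetD[OF cube]) auto
    then obtain p where p: "p \<in> W" "q p = (u, v, t)"
      by (metis imageE)
    then have uvt: "p $ 1 + p $ 4 = u" "p $ 2 + p $ 4 = v" "p $ 4 = t"
      and uvt': "(p + e) $ 1 + (p + e) $ 4 = u" "(p + e) $ 2 + (p + e) $ 4 = v" "(p + e) $ 4 = t"
      by (simp_all add: q_def e_def axis_def)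
    have K': "p \<in> K" "p + e \<in> K"
      using p(1) by (auto simp: W_def)
    obtain x where x: "0 \<le> x" "x \<le> 1" "p = param m u v t x"
      by (rule body_fiber_over_corner[OF subsetD[OF K(3) K'(1)],
            unfolded uvt(1,2), unfolded uvt(3), OF bits])
    obtain y where y: "0 \<le> y" "y \<le> 1" "p + e = param m u v t y"
      by (rule body_fiber_over_corner[OF subsetD[OF K(3) K'(2)],
            unfolded uvt'(1,2), unfolded uvt'(3), OF bits])
    \<comment> \<open>Two points at distance one in a unit segment are its ends.\<close>
    have "y = x + 1"
      using y(3) by (simp add: x(3) vec4_eq_iff e_def axis_def)
    with x(1,2) y(1,2) have "x = 0" "y = 1"
      by linarith+
    with x(3) y(3) K' show ?thesis by metis
  qed
  have "corners m \<subseteq> K"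
  proof
    fix p assume "p \<in> corners m"
    then obtain u v t s where "p = param m u v t s" "u \<in> bits" "v \<in> bits" "t \<in> bits" "s \<in> bits"
      by (rule cornersE)
    then show "p \<in> K"
      using both[of u v t] by (metis insertE singletonD)
  qed
  then show ?thesis
    unfolding body_T_eq using \<open>convex K\<close> by (rule hull_minimal)
qed

lemma minimal_covering_pair_body_T: "minimal_covering_pair (body_T m) integer_lattice"
  unfolding minimal_covering_pair_def
  using full_rank_integer_lattice convex_body_body_T body_T_covers covering_subbody_contains_body[of _ m]
  by (auto simp: convex_body_def)

section \<open>Contact data determine the vertex set up to affine equivalence\<close>

lemma face_carrier_vertex:
  assumes "v extreme_point_of K"
  shows "face_carrier K v = {v}"
  unfolding face_carrier_def
proof (rule the_equality)
  show v: "{v} face_of K \<and> v \<in> rel_interior {v}"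
    using assms by (simp add: face_of_singleton)
  show "F = {v}" if "F face_of K \<and> v \<in> rel_interior F" for F
    using that v face_of_eq[of F K "{v}"] by blast
qed

text \<open>The difference \<open>w - v\<close> is a contact vector at \<open>v\<close> with carrier \<open>{w}\<close>, which \<open>\<Phi>\<close> maps to
  \<open>{\<phi> w}\<close>. Its image \<open>U (w - v)\<close> is a contact vector at \<open>\<phi> v\<close>. Since all lattice points of \<open>K'\<close>
  are vertices, \<open>\<phi> v + U (w - v)\<close> is a vertex, so its own carrier consists of this point alone and
  comparing the two carriers gives the equation.\<close>

lemma profile_isomorphism_vertex_difference:
  assumes iso: "profile_isomorphism K L K' L' U \<phi> \<Phi>"
    and sub: "vertices K \<subseteq> L" "vertices K' \<subseteq> L'"
    and L: "\<And>x y. x \<in> L \<Longrightarrow> y \<in> L \<Longrightarrow> x - y \<in> L"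
    and L': "\<And>x y. x \<in> L' \<Longrightarrow> y \<in> L' \<Longrightarrow> x + y \<in> L'"
    and K': "K' \<inter> L' \<subseteq> vertices K'"
    and v: "v \<in> vertices K" and w: "w \<in> vertices K"
  shows "\<phi> w = \<phi> v + U (w - v)"
proof -
  have \<phi>: "bij_betw \<phi> (vertices K) (vertices K')"
    and single: "\<Phi> {w} = {\<phi> w}"
    and contact: "U ` contact_set K L v = contact_set K' L' (\<phi> v)"
    and carrier: "\<And>z. z \<in> contact_set K L v \<Longrightarrow>
      \<Phi> (carrier_map K v z) = carrier_map K' (\<phi> v) (U z)"
    using iso v w unfolding profile_isomorphism_def by auto
  have "w - v \<in> L"
    using v w sub(1) by (intro L) auto
  then have z: "w - v \<in> contact_set K L v"
    using w by (simp add: contact_set_def vertices_def extreme_point_of_def)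
  then have "U (w - v) \<in> contact_set K' L' (\<phi> v)"
    using contact by blast
  moreover have "\<phi> v \<in> L'"
    using \<phi> v sub by (auto simp: bij_betw_def)
  ultimately have "\<phi> v + U (w - v) \<in> K' \<inter> L'"
    using L' by (auto simp: contact_set_def)
  then have "\<phi> v + U (w - v) extreme_point_of K'"
    using K' by (auto simp: vertices_def)
  then have "carrier_map K' (\<phi> v) (U (w - v)) = {\<phi> v + U (w - v)}"
    by (simp add: carrier_map_def face_carrier_vertex)
  moreover have "carrier_map K v (w - v) = {w}"
    using w by (simp add: carrier_map_def face_carrier_vertex vertices_def)
  ultimately show ?thesis
    using carrier[OF z] single by simp
qed

section \<open>An affine invariant that recovers the parameter\<close>

text \<open>Only differences of points of \<open>V\<close> occur, so the set of ratios does not change under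
  maps which act on differences as an injective additive map.\<close>

definition affine_ratios :: "'a::real_vector set \<Rightarrow> nat set" where
  "affine_ratios V = {k. \<exists>a\<in>V. \<exists>b\<in>V. \<exists>c\<in>V. \<exists>d\<in>V. \<exists>e\<in>V. \<exists>f\<in>V.
     e \<noteq> f \<and> (a - c) + (b - d) = real k *\<^sub>R (e - f)}"

lemma affine_ratios_invariant:
  fixes U :: "'a::real_vector \<Rightarrow> 'b::real_vector"
  assumes bij: "bij_betw \<phi> V V'" and sub: "V \<subseteq> L" and inj: "inj_on U L"
    and U: "\<And>x y. x \<in> L \<Longrightarrow> y \<in> L \<Longrightarrow> U (x + y) = U x + U y"
    and L: "\<And>x y. x \<in> L \<Longrightarrow> y \<in> L \<Longrightarrow> x + y \<in> L" "\<And>x y. x \<in> L \<Longrightarrow> y \<in> L \<Longrightarrow> x - y \<in> L"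
    and diff: "\<And>v w. v \<in> V \<Longrightarrow> w \<in> V \<Longrightarrow> \<phi> w - \<phi> v = U (w - v)"
  shows "affine_ratios V' = affine_ratios V"
proof -
  have V': "V' = \<phi> ` V" and inj_\<phi>: "inj_on \<phi> V"
    using bij by (auto simp: bij_betw_def)
  have mult: "real k *\<^sub>R x \<in> L \<and> U (real k *\<^sub>R x) = real k *\<^sub>R U x" if "x \<in> L" for x k
  proof (induction k)
    case 0
    have "0 \<in> L"
      using L(2)[OF that that] by simp
    then show ?case
      using U[of 0 0] by simp
  next
    case (Suc k)
    then show ?case
      using that U[of x "real k *\<^sub>R x"] L(1)[of x "real k *\<^sub>R x"] by (simp add: scaleR_add_left)
  qed
  have "(\<phi> a - \<phi> c) + (\<phi> b - \<phi> d) = real k *\<^sub>R (\<phi> e - \<phi> f) \<longleftrightarrow>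
      (a - c) + (b - d) = real k *\<^sub>R (e - f)"
    if "a \<in> V" "b \<in> V" "c \<in> V" "d \<in> V" "e \<in> V" "f \<in> V" for a b c d e f k
  proof -
    have in_L: "a - c \<in> L" "b - d \<in> L" "e - f \<in> L"
      using that sub by (auto intro: L(2))
    have "(\<phi> a - \<phi> c) + (\<phi> b - \<phi> d) = U ((a - c) + (b - d))"
      using that in_L by (simp add: diff U)
    moreover have "real k *\<^sub>R (\<phi> e - \<phi> f) = U (real k *\<^sub>R (e - f))"
      using that in_L mult by (simp add: diff)
    moreover have "U ((a - c) + (b - d)) = U (real k *\<^sub>R (e - f)) \<longleftrightarrow> (a - c) + (b - d) = real k *\<^sub>R (e - f)"
      using in_L mult L(1) by (intro inj_on_eq_iff[OF inj]) auto
    ultimately show ?thesis by simp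
  qed
  moreover have "\<phi> e \<noteq> \<phi> f \<longleftrightarrow> e \<noteq> f" if "e \<in> V" "f \<in> V" for e f
    using that inj_\<phi> by (auto simp: inj_on_def)
  ultimately show ?thesis
    unfolding affine_ratios_def V' bex_simps by (simp cong: bex_cong conj_cong)
qed

lemma bits_add_eq:
  assumes "a \<in> bits" "b \<in> bits" "c \<in> bits" "d \<in> bits" "(a - c) + (b - d) = 0"
  shows "c = a \<and> d = b \<or> c = b \<and> d = a"
  using assms by auto

text \<open>When two pairs of corners of the cube have the same sum, the second pair arises from the first
  by exchanging some coordinates. Up to the factor \<open>m\<close> the height is \<open>u v\<close> on the bottom face and
  \<open>- (1 - u) (1 - v)\<close> on the top face, and such an exchange changes the sum of two of these values by
  at most one.\<close>

lemma height_second_difference_le: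
  assumes "u\<^sub>a \<in> bits" "u\<^sub>b \<in> bits" "v\<^sub>a \<in> bits" "v\<^sub>b \<in> bits" "t\<^sub>a \<in> bits" "t\<^sub>b \<in> bits"
    and "u\<^sub>c = u\<^sub>a \<and> u\<^sub>d = u\<^sub>b \<or> u\<^sub>c = u\<^sub>b \<and> u\<^sub>d = u\<^sub>a"
    and "v\<^sub>c = v\<^sub>a \<and> v\<^sub>d = v\<^sub>b \<or> v\<^sub>c = v\<^sub>b \<and> v\<^sub>d = v\<^sub>a"
    and "t\<^sub>c = t\<^sub>a \<and> t\<^sub>d = t\<^sub>b \<or> t\<^sub>c = t\<^sub>b \<and> t\<^sub>d = t\<^sub>a"
  shows "\<bar>(height m u\<^sub>a v\<^sub>a t\<^sub>a - height m u\<^sub>c v\<^sub>c t\<^sub>c) + (height m u\<^sub>b v\<^sub>b t\<^sub>b - height m u\<^sub>d v\<^sub>d t\<^sub>d)\<bar> \<le> real m"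
  using assms(7-9)
  by (elim disjE conjE; hypsubst)
     (use assms(1-6) in \<open>auto simp: height_def\<close>)

lemma bits_ratio_le:
  fixes k :: nat
  assumes "a \<in> bits" "b \<in> bits" "c \<in> bits" "d \<in> bits" "e \<in> bits" "f \<in> bits"
    and "(a - c) + (b - d) = real k * (e - f)" "2 < k"
  shows "e = f"
proof (rule ccontr)
  assume "e \<noteq> f"
  then have "\<bar>real k * (e - f)\<bar> = real k"
    using assms(5,6) by auto
  moreover have "\<bar>(a - c) + (b - d)\<bar> \<le> 2"
    using assms(1-4) by auto
  ultimately show False
    using assms(7,8) by simp
qed

text \<open>Let \<open>k > 2\<close>. The cube coordinates of \<open>(a - c) + (b - d)\<close> have absolute value at most \<open>2\<close>,
  so \<open>e\<close> and \<open>f\<close> agree in them and differ by \<open>\<plusminus>e\<^sub>3\<close>. Then \<open>k\<close> is the absolute value of the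
  third coordinate of \<open>(a - c) + (b - d)\<close>; the heights contribute at most \<open>m\<close> to it and the positions
  in the two pairs of unit segments at most \<open>2\<close>.\<close>

lemma affine_ratios_corners_le:
  assumes "k \<in> affine_ratios (corners m)"
  shows "k \<le> m + 2"
proof (cases "2 < k")
  case True
  obtain a b c d e f where in_V: "a \<in> corners m" "b \<in> corners m" "c \<in> corners m" "d \<in> corners m"
      "e \<in> corners m" "f \<in> corners m" and "e \<noteq> f" and rel: "(a - c) + (b - d) = real k *\<^sub>R (e - f)"
    using assms unfolding affine_ratios_def by blast
  obtain ua va ta sa where a: "a = param m ua va ta sa" "ua \<in> bits" "va \<in> bits" "ta \<in> bits" "sa \<in> bits"
    using in_V(1) by (rule cornersE)
  obtain ub vb tb sb where b: "b = param m ub vb tb sb" "ub \<in> bits" "vb \<in> bits" "tb \<in> bits" "sb \<in> bits"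
    using in_V(2) by (rule cornersE)
  obtain uc vc tc sc where c: "c = param m uc vc tc sc" "uc \<in> bits" "vc \<in> bits" "tc \<in> bits" "sc \<in> bits"
    using in_V(3) by (rule cornersE)
  obtain ud vd td sd where d: "d = param m ud vd td sd" "ud \<in> bits" "vd \<in> bits" "td \<in> bits" "sd \<in> bits"
    using in_V(4) by (rule cornersE)
  obtain ue ve te se where e: "e = param m ue ve te se" "ue \<in> bits" "ve \<in> bits" "te \<in> bits" "se \<in> bits"
    using in_V(5) by (rule cornersE)
  obtain uf vf tf sf where f: "f = param m uf vf tf sf" "uf \<in> bits" "vf \<in> bits" "tf \<in> bits" "sf \<in> bits"
    using in_V(6) by (rule cornersE)
  have nth: "(a $ i - c $ i) + (b $ i - d $ i) = real k * (e $ i - f $ i)" for i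
    using rel by (metis vector_add_component vector_minus_component vector_scaleR_component real_scaleR_def)
  have t: "(ta - tc) + (tb - td) = real k * (te - tf)"
    using nth[of 4] by (simp add: a b c d e f)
  have u: "(ua - uc) + (ub - ud) = real k * (ue - uf)"
    using nth[of 1] t by (simp add: a b c d e f algebra_simps)
  have v: "(va - vc) + (vb - vd) = real k * (ve - vf)"
    using nth[of 2] t by (simp add: a b c d e f algebra_simps)
  have eq: "ue = uf" "ve = vf" "te = tf"
    by (rule bits_ratio_le[OF a(2) b(2) c(2) d(2) e(2) f(2) u True]
        bits_ratio_le[OF a(3) b(3) c(3) d(3) e(3) f(3) v True]
        bits_ratio_le[OF a(4) b(4) c(4) d(4) e(4) f(4) t True])+
  have "se \<noteq> sf"
    using \<open>e \<noteq> f\<close> eq by (auto simp: e f)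
  then have "real k = \<bar>real k * (se - sf)\<bar>"
    using e(5) f(5) by auto
  also have "real k * (se - sf) = (height m ua va ta - height m uc vc tc)
      + (height m ub vb tb - height m ud vd td) + ((sa - sc) + (sb - sd))"
    using nth[of 3] t by (simp add: a b c d e f eq algebra_simps)
  also have "\<bar>\<dots>\<bar> \<le> real m + 2"
  proof -
    have "\<bar>(height m ua va ta - height m uc vc tc) + (height m ub vb tb - height m ud vd td)\<bar> \<le> real m"
      using t u v by (intro height_second_difference_le bits_add_eq a b c d) (simp_all add: eq)
    moreover have "\<bar>(sa - sc) + (sb - sd)\<bar> \<le> 2"
      using a(5) b(5) c(5) d(5) by auto
    ultimately show ?thesis by linarith
  qed
  finally show ?thesis by linarith
qed simp

text \<open>The relation comes from the bottom slice: \<open>m\<close> is the failure of the four lower corners of the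
  prism to be coplanar, and \<open>2\<close> is gained by using upper ends for \<open>a\<close> and \<open>b\<close>
  and lower ends for \<open>c\<close> and \<open>d\<close>.\<close>

lemma affine_ratios_corners_max: "m + 2 \<in> affine_ratios (corners m)"
proof -
  have "(param m 1 1 0 1 - param m 1 0 0 0) + (param m 0 0 0 1 - param m 0 1 0 0)
      = real (m + 2) *\<^sub>R (param m 0 0 0 1 - param m 0 0 0 0)"
    by (simp add: vec4_eq_iff height_def)
  moreover have "param m 0 0 0 1 \<noteq> param m 0 0 0 0"
    by (simp add: vec4_eq_iff)
  ultimately show ?thesis
    unfolding affine_ratios_def by (blast intro: param_mem_corners)
qed

lemma same_type_imp_eq:
  assumes "same_arithmetic_contact_type (body_T m) integer_lattice (body_T m') integer_lattice"
  shows "m = m'"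
proof -
  obtain U \<phi> \<Phi> where iso: "profile_isomorphism (body_T m) integer_lattice (body_T m') integer_lattice U \<phi> \<Phi>"
    using assms unfolding same_arithmetic_contact_type_def by blast
  have lattice: "x + y \<in> integer_lattice" "x - y \<in> integer_lattice"
    if "x \<in> integer_lattice" "y \<in> integer_lattice" for x y :: "real ^ 4"
    using that by (auto simp: integer_lattice_def)
  have sub: "vertices (body_T n) \<subseteq> integer_lattice" "body_T n \<inter> integer_lattice \<subseteq> vertices (body_T n)" for n
    using lattice_points_of_body[of n] by (auto simp: vertices_body_T)
  have diff: "\<phi> w - \<phi> v = U (w - v)" if "v \<in> corners m" "w \<in> corners m" for v w
    using profile_isomorphism_vertex_difference[OF iso sub(1) sub(1) lattice(2) lattice(1) sub(2), of v w] that
    by (simp add: vertices_body_T)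
  have "affine_ratios (corners m') = affine_ratios (corners m)"
  proof (rule affine_ratios_invariant[where L = integer_lattice])
    show "bij_betw \<phi> (corners m) (corners m')" "inj_on U integer_lattice"
      "\<And>x y. x \<in> integer_lattice \<Longrightarrow> y \<in> integer_lattice \<Longrightarrow> U (x + y) = U x + U y"
      using iso by (auto simp: profile_isomorphism_def lattice_isomorphism_def vertices_body_T bij_betw_def)
    show "corners m \<subseteq> integer_lattice"
      using sub(1)[of m] by (simp add: vertices_body_T)
  qed (use lattice diff in auto)
  then have "m + 2 \<le> m' + 2" "m' + 2 \<le> m + 2"
    using affine_ratios_corners_max[of m] affine_ratios_corners_max[of m']
      affine_ratios_corners_le[of "m + 2" m'] affine_ratios_corners_le[of "m' + 2" m] by auto
  then show ?thesis by simp
qed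

theorem theorem1p3:
  shows "(\<forall>m::nat. m > 0 \<longrightarrow>
            centrally_symmetric (body_T m) \<and>
            minimal_covering_pair (body_T m) (integer_lattice :: (real ^ 4) set)) \<and>
         (\<forall>m m'::nat. m > 0 \<and> m' > 0 \<and> m \<noteq> m' \<longrightarrow>
            \<not> same_arithmetic_contact_type
                (body_T m) integer_lattice (body_T m') integer_lattice)"
  using centrally_symmetric_body_T minimal_covering_pair_body_T same_type_imp_eq by blast

end
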